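(* Let $c_a,\kappa,\lambda\in\mathbb{R}$ satisfy $c_a-\kappa\le 1$ and $0<\lambda\le e\,(c_a-\kappa)$, and consider the induced foraging game with $N$ robots. When a human recruits (removes) $k$ robots, with $1\le k<N$, for an external task, the upper threshold $\overline{\theta}$ at which foraging becomes a strictly dominant strategy decreases; that is, $\overline{\theta}(N-k)<\overline{\theta}(N)$.
   Context: Each robot in a homogeneous team chooses an action $a\in\{0,1\}$, where $a=1$ means "forage" and $a=0$ means "idle". The real parameter $\theta$ is a global signal (urgency of the task) and $n$ is the number of other robots that forage. Each robot's utility is $$u(a,n,\theta)=-(n+a)\,c_a+a\big(\kappa+\lambda e^{-(n+1)}+\theta\big),$$ and its marginal utility is $$\pi(n,\theta)=u(1,n,\theta)-u(0,n,\theta)=-c_a+\kappa+\lambda e^{-(n+1)}+\theta.$$ In a game with $M$ robots, $n$ ranges over $\{0,1,\dots,M-1\}$. An action $a^*$ is a strictly dominant strategy for a given $\theta$ if $u(a^*,n,\theta)>u(a',n,\theta)$ for all admissible $n$ and $a'\ne a^*$. The upper threshold $\overline{\theta}(M)$ of the game with $M$ robots is the infimum of the set of $\theta\in\mathbb{R}$ for which foraging ($a=1$) is a strictly dominant strategy. Recruiting $k$ robots turns the game with $N$ robots into the game with $N-k$ robots. *)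

theory Defs
  imports Complex_Main
begin

text \<open>Action \<open>1\<close> is "forage" and action \<open>0\<close> is "idle".\<close>

definition actions :: "nat set" where
  "actions = {0, 1}"

definition utility :: "real \<Rightarrow> real \<Rightarrow> real \<Rightarrow> nat \<Rightarrow> nat \<Rightarrow> real \<Rightarrow> real" where
  "utility c \<kappa> l a n \<theta> =
     - (real n + real a) * c + real a * (\<kappa> + l * exp (- (real n + 1)) + \<theta>)"

text \<open>In the game with \<open>M\<close> robots, the number \<open>n\<close> of other foraging robots ranges over
  \<open>{0, \<dots>, M - 1}\<close>.\<close>

definition strictly_dominant ::
    "real \<Rightarrow> real \<Rightarrow> real \<Rightarrow> nat \<Rightarrow> real \<Rightarrow> nat \<Rightarrow> bool" where
  "strictly_dominant c \<kappa> l M \<theta> a \<longleftrightarrow>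
     a \<in> actions \<and>
     (\<forall>n<M. \<forall>a'\<in>actions. a' \<noteq> a \<longrightarrow> utility c \<kappa> l a n \<theta> > utility c \<kappa> l a' n \<theta>)"

text \<open>For \<open>M \<ge> 1\<close> the set below is nonempty and bounded below, so \<open>Inf\<close> is its greatest lower
  bound; for \<open>M = 0\<close> dominance is vacuous and the value is meaningless.\<close>

definition upper_threshold :: "real \<Rightarrow> real \<Rightarrow> real \<Rightarrow> nat \<Rightarrow> real" where
  "upper_threshold c \<kappa> l M = Inf {\<theta>. strictly_dominant c \<kappa> l M \<theta> 1}"

end

theory Submission
  imports Defs
begin

text \<open>Foraging beats idling against \<open>n\<close> others iff
  \<open>c - \<kappa> - l * exp (- (real n + 1)) < \<theta>\<close>. For \<open>l \<ge> 0\<close>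
  the left side grows with \<open>n\<close>, so the most crowded case \<open>n = M - 1\<close>
  decides dominance. The threshold is thus \<open>c - \<kappa> - l * exp (- real M)\<close>
  (\<open>upper_threshold_eq\<close>), which for \<open>l > 0\<close> strictly increases with
  \<open>M\<close>; removing robots lowers it.\<close>

lemma strictly_dominant_forage_iff:
  assumes "0 \<le> l" and "1 \<le> M"
  shows "strictly_dominant c \<kappa> l M \<theta> 1 \<longleftrightarrow> c - \<kappa> - l * exp (- real M) < \<theta>"
proof -
  have "strictly_dominant c \<kappa> l M \<theta> 1 \<longleftrightarrow>
      (\<forall>n<M. c - \<kappa> - l * exp (- (real n + 1)) < \<theta>)"
    by (auto simp: strictly_dominant_def actions_def utility_def algebra_simps)
  also have "\<dots> \<longleftrightarrow> c - \<kappa> - l * exp (- real M) < \<theta>"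
  proof
    assume *: "\<forall>n<M. c - \<kappa> - l * exp (- (real n + 1)) < \<theta>"
    \<comment> \<open>The binding case: all other robots forage.\<close>
    have "c - \<kappa> - l * exp (- (real (M - 1) + 1)) < \<theta>"
      using \<open>1 \<le> M\<close> by (intro *[rule_format]) simp
    then show "c - \<kappa> - l * exp (- real M) < \<theta>"
      using \<open>1 \<le> M\<close> by (simp add: of_nat_diff)
  next
    assume *: "c - \<kappa> - l * exp (- real M) < \<theta>"
    show "\<forall>n<M. c - \<kappa> - l * exp (- (real n + 1)) < \<theta>"
    proof (intro allI impI)
      fix n assume "n < M"
      then have "l * exp (- real M) \<le> l * exp (- (real n + 1))"
        using \<open>0 \<le> l\<close> by (intro mult_left_mono) auto
      with * show "c - \<kappa> - l * exp (- (real n + 1)) < \<theta>"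
        by linarith
    qed
  qed
  finally show ?thesis .
qed

lemma upper_threshold_eq:
  assumes "0 \<le> l" and "1 \<le> M"
  shows "upper_threshold c \<kappa> l M = c - \<kappa> - l * exp (- real M)"
  using assms
  \<comment> \<open>The set is the open ray above the bound, whose \<open>Inf\<close> is its
    endpoint. \<open>[simplified]\<close> turns the action \<open>1\<close> into
    \<open>Suc 0\<close>, the form that simp gives it in the goal.\<close>
  by (simp add: upper_threshold_def strictly_dominant_forage_iff[simplified]
      flip: greaterThan_def)

theorem lemma2:
  fixes c \<kappa> l :: real and N k :: nat
  assumes "c - \<kappa> \<le> 1"
    and "0 < l"
    and "l \<le> exp 1 * (c - \<kappa>)"
    and "1 \<le> k"
    and "k < N"
  shows "upper_threshold c \<kappa> l (N - k) < upper_threshold c \<kappa> l N"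
  \<comment> \<open>\<open>k < N\<close> keeps \<open>N - k \<ge> 1\<close>, so the formula applies
    to both games.\<close>
  using assms by (simp add: upper_threshold_eq)

end
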